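(* Let $K$ be a compact Hausdorff space and let $E$ be a real Banach space that is a local-GL-space. Then $C(K,E)$ is a local-GL-space.
   Context: All spaces are over the real field. $B_E$, $S_E$, $E^*$ denote the closed unit ball, the unit sphere and the dual of $E$. $C(K,E)$ is the Banach space of all continuous functions from $K$ into $E$ with the supremum norm. A Banach space $E$ is a GL-space (generalized-lush space) if for every $x\in S_E$ and every $\varepsilon>0$ there is $x^*\in S_{E^*}$ such that, with $S=S(x^*,\varepsilon)=\{z\in B_E: x^*(z)>1-\varepsilon\}$, one has $x\in S$ and $\mathrm{dist}(y,S)+\mathrm{dist}(y,-S)<2+\varepsilon$ for all $y\in S_E$. A Banach space $E$ is a local-GL-space if for every separable subspace $X\subset E$ there is a (closed) subspace $Y$ of $E$ which is a GL-space (with the inherited norm) and satisfies $X\subset Y\subset E$. *)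

theory Defs
  imports "HOL-Analysis.Analysis"
begin

text \<open>
  A Banach space is rendered as a complete linear subspace of an ambient real normed space, so that
  the same notions apply to a whole space (the carrier \<^term>\<open>UNIV\<close>) and to a subspace with the
  inherited norm.
\<close>

definition banach_subspace :: "'a::real_normed_vector set \<Rightarrow> bool" where
  "banach_subspace Y \<longleftrightarrow> subspace Y \<and> complete Y"

definition unit_ball_of :: "'a::real_normed_vector set \<Rightarrow> 'a set" where
  "unit_ball_of Y = {z \<in> Y. norm z \<le> 1}"

definition unit_sphere_of :: "'a::real_normed_vector set \<Rightarrow> 'a set" where
  "unit_sphere_of Y = {z \<in> Y. norm z = 1}"

text \<open>
  The unit sphere of the dual of \<open>Y\<close>. Functionals on \<open>Y\<close> are represented by functions on the ambient
  type of which only the values on \<open>Y\<close> are constrained; linearity, boundedness and the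
  dual norm are all taken on \<open>Y\<close>. The boundedness clause is needed because \<^const>\<open>Sup\<close> is
  unspecified on unbounded sets of reals.
\<close>

definition dual_sphere_of :: "'a::real_normed_vector set \<Rightarrow> ('a \<Rightarrow> real) set" where
  "dual_sphere_of Y = {f.
     (\<forall>x\<in>Y. \<forall>y\<in>Y. f (x + y) = f x + f y) \<and>
     (\<forall>c. \<forall>x\<in>Y. f (c *\<^sub>R x) = c * f x) \<and>
     bdd_above ((\<lambda>z. \<bar>f z\<bar>) ` unit_ball_of Y) \<and>
     (SUP z\<in>unit_ball_of Y. \<bar>f z\<bar>) = 1}"

definition slice :: "'a::real_normed_vector set \<Rightarrow> ('a \<Rightarrow> real) \<Rightarrow> real \<Rightarrow> 'a set" where
  "slice Y f \<epsilon> = {z \<in> unit_ball_of Y. f z > 1 - \<epsilon>}"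

text \<open>
  The convention \<^prop>\<open>infdist y {} = 0\<close> plays no role below, since the slice contains \<open>x\<close>.
\<close>

definition GL_space :: "'a::real_normed_vector set \<Rightarrow> bool" where
  "GL_space Y \<longleftrightarrow> banach_subspace Y \<and>
     (\<forall>x\<in>unit_sphere_of Y. \<forall>\<epsilon>>0. \<exists>f\<in>dual_sphere_of Y.
        x \<in> slice Y f \<epsilon> \<and>
        (\<forall>y\<in>unit_sphere_of Y.
           infdist y (slice Y f \<epsilon>) + infdist y (uminus ` slice Y f \<epsilon>) < 2 + \<epsilon>))"

definition local_GL_space :: "'a::real_normed_vector set \<Rightarrow> bool" where
  "local_GL_space E \<longleftrightarrow> banach_subspace E \<and>
     (\<forall>X. subspace X \<and> X \<subseteq> E \<and> separable_space (top_of_set X) \<longrightarrow>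
        (\<exists>Y. X \<subseteq> Y \<and> Y \<subseteq> E \<and> GL_space Y))"

text \<open>
  For compact \<open>K\<close>, the type of bounded continuous functions with its supremum norm is
  \<open>C(K, E)\<close>:
\<close>

lemma bcontfun_compact_UNIV:
  assumes "compact (UNIV :: 'k::topological_space set)"
  shows "(bcontfun :: ('k \<Rightarrow> 'e::metric_space) set) = {f. continuous_on UNIV f}"
  using assms by (auto simp: bcontfun_def intro: compact_imp_bounded compact_continuous_image)

end

theory Submission
  imports Defs
begin

text \<open>
  The values of the functions in a separable subspace \<open>X\<close> of \<open>C(K, E)\<close> lie in a separable subspace
  of \<open>E\<close>, hence in a subspace \<open>F\<close> that is a GL-space, and \<open>X \<subseteq> C(K, F)\<close>. The space \<open>C(K, F)\<close> is
  again a GL-space: given \<open>f\<close> of norm one, choose \<open>t\<close> with \<open>norm (f t) = 1\<close> and compose a functional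
  witnessing the GL-property of \<open>F\<close> at \<open>f t\<close> with evaluation at \<open>t\<close>. For
  \<open>h\<close> in the unit ball, a point \<open>p\<close> of the unit ball of \<open>F\<close> is the value at \<open>t\<close> of a function in the unit
  ball whose distance to \<open>h\<close> is arbitrarily close to \<open>dist (h t) p\<close>: interpolate between \<open>h\<close> and \<open>p\<close>
  on the set where \<open>h\<close> is close to \<open>h t\<close>.
\<close>

section \<open>Separability of spans and of the values of a separable family\<close>

lemma compact_imp_countable_dense:
  fixes S :: "'a::metric_space set"
  assumes "compact S"
  obtains D where "countable D" "D \<subseteq> S" "S \<subseteq> closure D"
proof -
  have "\<forall>n. \<exists>k. finite k \<and> k \<subseteq> S \<and> S \<subseteq> (\<Union>x\<in>k. ball x (inverse (real (Suc n))))"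
    using assms seq_compact_imp_totally_bounded[of S] by (simp add: compact_eq_seq_compact_metric)
  then obtain k where k: "\<And>n. finite (k n)" "\<And>n. k n \<subseteq> S"
      "\<And>n. S \<subseteq> (\<Union>x\<in>k n. ball x (inverse (real (Suc n))))"
    by metis
  show thesis
  proof
    show "countable (\<Union>n. k n)"
      using k(1) by (auto intro: countable_finite)
    show "(\<Union>n. k n) \<subseteq> S"
      using k(2) by blast
    show "S \<subseteq> closure (\<Union>n. k n)"
    proof
      fix x assume "x \<in> S"
      show "x \<in> closure (\<Union>n. k n)"
        unfolding closure_approachable
      proof (intro allI impI)
        fix e :: real assume "e > 0"
        then obtain n where "inverse (real (Suc n)) < e"
          using reals_Archimedean by blast
        moreover obtain y where "y \<in> k n" "dist y x < inverse (real (Suc n))"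
          using k(3)[of n] \<open>x \<in> S\<close> by auto
        ultimately show "\<exists>y\<in>\<Union>n. k n. dist y x < e"
          by (intro bexI[of _ y]) auto
      qed
    qed
  qed
qed

lemma separable_space_closure_countable:
  fixes Q :: "'a::topological_space set"
  assumes "countable Q"
  shows "separable_space (top_of_set (closure Q))"
  unfolding separable_space_def
proof (intro exI conjI)
  show "countable Q" by fact
  show "Q \<subseteq> topspace (top_of_set (closure Q))"
    by (simp add: closure_subset)
  show "top_of_set (closure Q) closure_of Q = topspace (top_of_set (closure Q))"
    by (simp add: closure_of_subtopology closure_subset Int_absorb1)
qed

text \<open>Addition and scalar multiplication are jointly continuous, so stability passes from
  \<open>Q\<close> to its closure. Rational scalars suffice because the closure of
  \<open>\<rat>\<close> is the whole line. This serves both for countable sets of rational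
  combinations and for ordinary spans.\<close>

lemma subspace_closure_Rats:
  fixes Q :: "'a::real_normed_vector set"
  assumes addQ: "\<And>x y. x \<in> Q \<Longrightarrow> y \<in> Q \<Longrightarrow> x + y \<in> Q"
    and scaleQ: "\<And>r x. r \<in> \<rat> \<Longrightarrow> x \<in> Q \<Longrightarrow> r *\<^sub>R x \<in> Q"
    and "Q \<noteq> {}"
  shows "subspace (closure Q)"
proof (rule subspaceI)
  obtain x where "x \<in> Q"
    using \<open>Q \<noteq> {}\<close> by blast
  from scaleQ[OF Rats_0 this] show "0 \<in> closure Q"
    using closure_subset by fastforce
  have "(\<lambda>(x, y). x + y) ` closure (Q \<times> Q) \<subseteq> closure Q"
  proof (rule image_closure_subset)
    show "continuous_on (closure (Q \<times> Q)) (\<lambda>(x, y). x + y)"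
      unfolding split_beta by (intro continuous_intros)
    show "(\<lambda>(x, y). x + y) ` (Q \<times> Q) \<subseteq> closure Q"
      using addQ closure_subset[of Q] by auto
  qed simp
  then show "x + y \<in> closure Q" if "x \<in> closure Q" "y \<in> closure Q" for x y
    using that by (auto simp: closure_Times)
  have "(\<lambda>(r, x). r *\<^sub>R x) ` closure (\<rat> \<times> Q) \<subseteq> closure Q"
  proof (rule image_closure_subset)
    show "continuous_on (closure (\<rat> \<times> Q)) (\<lambda>(r, x). r *\<^sub>R x)"
      unfolding split_beta by (intro continuous_intros)
    show "(\<lambda>(r, x). r *\<^sub>R x) ` (\<rat> \<times> Q) \<subseteq> closure Q"
      using scaleQ closure_subset[of Q] by auto
  qed simp
  then show "c *\<^sub>R x \<in> closure Q" if "x \<in> closure Q" for c x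
    using that by (auto simp: closure_Times Rats_closure_real)
qed

text \<open>The rational combinations of \<open>D\<close> form a countable set \<open>Q\<close> with
  \<open>D \<subseteq> Q \<subseteq> span D\<close>. The closure of \<open>Q\<close> is already a
  subspace, so it contains \<open>span D\<close>, and the two closures coincide.\<close>

lemma separable_space_closure_span:
  fixes D :: "'a::real_normed_vector set"
  assumes "countable D"
  shows "separable_space (top_of_set (closure (span D)))"
proof -
  \<comment> \<open>Encoding combinations by finite lists of coefficient-vector pairs makes
    countability immediate and turns addition into concatenation.\<close>
  define comb where "comb = (\<lambda>l::(real \<times> 'a) list. sum_list (map (\<lambda>(r, d). r *\<^sub>R d) l))"
  define Q where "Q = comb ` lists (\<rat> \<times> D)"
  have cntQ: "countable Q"
    unfolding Q_def using assms countable_rat by (intro countable_image countable_lists countable_SIGMA)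
  have addQ: "x + y \<in> Q" if "x \<in> Q" "y \<in> Q" for x y
  proof -
    obtain k l where "k \<in> lists (\<rat> \<times> D)" "x = comb k" "l \<in> lists (\<rat> \<times> D)" "y = comb l"
      using \<open>x \<in> Q\<close> \<open>y \<in> Q\<close> unfolding Q_def by blast
    then show ?thesis
      unfolding Q_def by (intro image_eqI[of _ _ "k @ l"]) (simp_all add: comb_def)
  qed
  have scaleQ: "r *\<^sub>R x \<in> Q" if "r \<in> \<rat>" "x \<in> Q" for r x
  proof -
    have "r *\<^sub>R comb l \<in> Q" if "l \<in> lists (\<rat> \<times> D)" for l
      using that
    proof (induction l)
      case Nil
      show ?case
        unfolding Q_def by (intro image_eqI[of _ _ "[]"]) (simp_all add: comb_def)
    next
      case (Cons p l)
      obtain q d where p: "p = (q, d)" "q \<in> \<rat>" "d \<in> D"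
        using Cons.hyps by (cases p) auto
      have "(r * q) *\<^sub>R d \<in> Q"
        unfolding Q_def using p \<open>r \<in> \<rat>\<close>
        by (intro image_eqI[of _ _ "[(r * q, d)]"]) (simp_all add: comb_def)
      from addQ[OF this Cons.IH] show ?case
        by (simp add: p comb_def scaleR_add_right)
    qed
    then show ?thesis
      using \<open>x \<in> Q\<close> unfolding Q_def by blast
  qed
  have DQ: "D \<subseteq> Q"
  proof
    fix d assume "d \<in> D"
    then show "d \<in> Q"
      unfolding Q_def by (intro image_eqI[of _ _ "[(1, d)]"]) (simp_all add: comb_def)
  qed
  have "Q \<noteq> {}"
    unfolding Q_def by blast
  with addQ scaleQ have "subspace (closure Q)"
    by (rule subspace_closure_Rats)
  with DQ have "span D \<subseteq> closure Q"
    by (meson closure_subset order_trans span_minimal)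
  moreover have "comb l \<in> span D" if "l \<in> lists (\<rat> \<times> D)" for l
    using that
    by (induction l) (auto simp: comb_def intro!: span_add span_scale intro: span_zero span_base)
  then have "Q \<subseteq> span D"
    unfolding Q_def by blast
  ultimately have "closure (span D) = closure Q"
    by (metis closure_closure closure_mono subset_antisym)
  then show ?thesis
    using separable_space_closure_countable[OF cntQ] by simp
qed

text \<open>Each single function has compact, hence separable, range. A countable dense subset
  \<open>C\<close> of \<open>X\<close> therefore produces only countably many vectors, and the
  values of any other function in \<open>X\<close> are limits of values of functions in
  \<open>C\<close>, since norm convergence implies pointwise convergence.\<close>

lemma separable_values:
  fixes X :: "('k::topological_space \<Rightarrow>\<^sub>C 'e::real_normed_vector) set"
  assumes "compact (UNIV :: 'k set)" and "separable_space (top_of_set X)"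
  obtains Z where "subspace Z" "separable_space (top_of_set Z)"
    "\<And>g t. g \<in> X \<Longrightarrow> apply_bcontfun g t \<in> Z"
proof -
  obtain C where C: "countable C" "C \<subseteq> X" "top_of_set X closure_of C = X"
    using assms(2) unfolding separable_space_def by auto
  have "X \<subseteq> closure C"
    using C by (metis closure_of_subtopology euclidean_closure_of inf_le2 Int_absorb1)
  have "\<exists>D. countable D \<and> range (apply_bcontfun g) \<subseteq> closure D" for g :: "'k \<Rightarrow>\<^sub>C 'e"
    by (rule compact_imp_countable_dense[of "range (apply_bcontfun g)"])
      (use assms(1) in \<open>auto intro: compact_continuous_image\<close>)
  then obtain D where D: "\<And>g. countable (D g)"
      "\<And>g :: 'k \<Rightarrow>\<^sub>C 'e. range (apply_bcontfun g) \<subseteq> closure (D g)"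
    by metis
  define D' where "D' = (\<Union>g\<in>C. D g)"
  show thesis
  proof
    show "subspace (closure (span D'))"
      by (rule subspace_closure_Rats) (auto intro: span_add span_scale span_zero)
    show "separable_space (top_of_set (closure (span D')))"
      using C(1) D(1) unfolding D'_def by (intro separable_space_closure_span) auto
    fix g t assume "g \<in> X"
    \<comment> \<open>Two approximations are involved: \<open>g t\<close> by some \<open>c t\<close>
      with \<open>c \<in> C\<close>, and \<open>c t\<close> by elements of \<open>D c\<close>. The
      doubled closure separates them.\<close>
    have "apply_bcontfun g t \<in> closure (closure (span D'))"
      unfolding closure_approachable[of "apply_bcontfun g t"]
    proof (intro allI impI)
      fix e :: real assume "e > 0"
      then obtain c where "c \<in> C" "dist c g < e"
        using \<open>g \<in> X\<close> \<open>X \<subseteq> closure C\<close> by (meson closure_approachable subsetD)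
      moreover have "D c \<subseteq> span D'"
        using \<open>c \<in> C\<close> span_superset[of D'] unfolding D'_def by blast
      then have "apply_bcontfun c t \<in> closure (span D')"
        using D(2)[of c] closure_mono by blast
      ultimately show "\<exists>y\<in>closure (span D'). dist y (apply_bcontfun g t) < e"
        using dist_fun_lt_imp_dist_val_lt by blast
    qed
    then show "apply_bcontfun g t \<in> closure (span D')"
      by simp
  qed
qed

section \<open>C(K, F) as a Banach subspace of C(K, E)\<close>

lemma banach_subspace_PiC:
  fixes F :: "'e::banach set"
  assumes "banach_subspace F"
  shows "banach_subspace (PiC UNIV (\<lambda>_. F) :: ('k::topological_space \<Rightarrow>\<^sub>C 'e) set)"
proof -
  have sub: "subspace F" and cl: "closed F"
    using assms by (auto simp: banach_subspace_def complete_imp_closed)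
  have "subspace (PiC UNIV (\<lambda>_. F) :: ('k \<Rightarrow>\<^sub>C 'e) set)"
    using sub by (intro subspaceI) (auto simp: mem_PiC_iff Pi_iff subspace_0 subspace_add subspace_scale)
  moreover have "complete (PiC UNIV (\<lambda>_. F) :: ('k \<Rightarrow>\<^sub>C 'e) set)"
    unfolding complete_def
  proof (intro allI impI)
    fix f :: "nat \<Rightarrow> 'k \<Rightarrow>\<^sub>C 'e"
    assume "(\<forall>n. f n \<in> PiC UNIV (\<lambda>_. F)) \<and> Cauchy f"
    then have fF: "\<And>n t. f n t \<in> F" and "Cauchy f"
      by (auto simp: mem_PiC_iff)
    then obtain g where g: "uniform_limit UNIV f g sequentially"
      using uniformly_convergent_eq_cauchy[of "\<lambda>_. True" f]
      unfolding Cauchy_def uniform_limit_sequentially_iff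
      by (metis dist_fun_lt_imp_dist_val_lt)
    obtain l where l: "g = apply_bcontfun l" "f \<longlonglongrightarrow> l"
      using uniform_limit_bcontfunE[OF g sequentially_bot] by metis
    \<comment> \<open>The uniform limit is again bounded and continuous. It takes values in
      \<open>F\<close> because it is a pointwise limit and \<open>F\<close>, being complete, is
      closed.\<close>
    have "l t \<in> F" for t
    proof (rule closed_sequentially[OF cl fF])
      show "(\<lambda>n. f n t) \<longlonglongrightarrow> l t"
        using g by (auto simp: l(1) intro: tendsto_uniform_limitI)
    qed
    then show "\<exists>l\<in>PiC UNIV (\<lambda>_. F). f \<longlonglongrightarrow> l"
      using l by (intro bexI[of _ l]) (auto simp: mem_PiC_iff)
  qed
  ultimately show ?thesis
    by (simp add: banach_subspace_def)
qed

section \<open>Slices and approximation of points of the unit ball\<close>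

lemma infdist_less_imp_ex:
  assumes "A \<noteq> {}" "infdist x A < d"
  shows "\<exists>a\<in>A. dist x a < d"
  using assms by (auto simp: infdist_notempty cInf_less_iff)

lemma subspace_uminus_iff:
  assumes "subspace Y"
  shows "- x \<in> Y \<longleftrightarrow> x \<in> Y"
  using assms subspace_neg by fastforce

lemma slice_convex_comb:
  assumes Y: "subspace Y" and f: "f \<in> dual_sphere_of Y"
    and p: "p \<in> slice Y f \<epsilon>" and q: "q \<in> slice Y f \<epsilon>"
    and ab: "0 \<le> a" "0 \<le> b" "a + b = 1"
  shows "a *\<^sub>R p + b *\<^sub>R q \<in> slice Y f \<epsilon>"
proof -
  have pq: "p \<in> Y" "q \<in> Y" "norm p \<le> 1" "norm q \<le> 1" "f p > 1 - \<epsilon>" "f q > 1 - \<epsilon>"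
    using p q by (auto simp: slice_def unit_ball_of_def)
  have "norm (a *\<^sub>R p + b *\<^sub>R q) \<le> 1"
    using ab pq convex_bound_le[of "norm p" 1 "norm q" a b]
    by (intro norm_triangle_le) simp
  moreover have "f (a *\<^sub>R p + b *\<^sub>R q) = a * f p + b * f q"
    using f pq subspace_scale[OF Y] by (simp add: dual_sphere_of_def)
  moreover have "a * f p + b * f q > 1 - \<epsilon>"
    using convex_bound_lt[of "- f p" "\<epsilon> - 1" "- f q" a b] ab pq by simp
  ultimately show ?thesis
    using pq Y by (simp add: slice_def unit_ball_of_def subspace_add subspace_scale)
qed

text \<open>
  The sum of the distances to \<open>S\<close> and \<open>-S\<close> is a convex even function, so the bound on the sphere
  extends to the ball.
\<close>

lemma slice_approx_ball:
  assumes Y: "subspace Y" and f: "f \<in> dual_sphere_of Y"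
    and x: "x \<in> unit_sphere_of Y" "x \<in> slice Y f \<epsilon>"
    and sphere: "\<And>y. y \<in> unit_sphere_of Y \<Longrightarrow>
      infdist y (slice Y f \<epsilon>) + infdist y (uminus ` slice Y f \<epsilon>) < 2 + \<epsilon>"
    and y: "y \<in> unit_ball_of Y"
  shows "\<exists>p\<in>slice Y f \<epsilon>. \<exists>q\<in>slice Y f \<epsilon>. dist y p + dist y (- q) < 2 + \<epsilon>"
proof -
  \<comment> \<open>The direction of \<open>y\<close>. For \<open>y = 0\<close> any unit vector
    serves, and \<open>x\<close> is one at hand.\<close>
  define u where "u = (if y = 0 then x else y /\<^sub>R norm y)"
  have u: "u \<in> unit_sphere_of Y" and yu: "y = norm y *\<^sub>R u"
    using x y subspace_scale[OF Y] by (auto simp: u_def unit_sphere_of_def unit_ball_of_def)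
  \<comment> \<open>Half of the slack in the bound at \<open>u\<close>: each of the two distances is
    exceeded by less than \<open>\<eta>\<close> when it is replaced by the distance to an actual
    point.\<close>
  define \<eta> where
    "\<eta> = (2 + \<epsilon> - (infdist u (slice Y f \<epsilon>) + infdist u (uminus ` slice Y f \<epsilon>))) / 2"
  have "\<eta> > 0"
    using sphere[OF u] by (simp add: \<eta>_def)
  then obtain p where p: "p \<in> slice Y f \<epsilon>" "dist u p < infdist u (slice Y f \<epsilon>) + \<eta>"
    using infdist_less_imp_ex[of "slice Y f \<epsilon>" u "infdist u (slice Y f \<epsilon>) + \<eta>"] x by auto
  obtain q where q: "q \<in> slice Y f \<epsilon>" "dist u (- q) < infdist u (uminus ` slice Y f \<epsilon>) + \<eta>"
    using infdist_less_imp_ex[of "uminus ` slice Y f \<epsilon>" u "infdist u (uminus ` slice Y f \<epsilon>) + \<eta>"]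
      x \<open>\<eta> > 0\<close> by auto
  have pq: "norm (u - p) + norm (u + q) < 2 + \<epsilon>"
    using p(2) q(2) by (simp add: dist_norm \<eta>_def field_simps)
  \<comment> \<open>These weights write \<open>y\<close> as the convex combination of
    \<open>u\<close> and \<open>- u\<close> with coefficients \<open>a\<close> and \<open>b\<close>.
    Since \<open>p\<close> is near \<open>u\<close> and \<open>q\<close> is near \<open>- u\<close>,
    the vector \<open>y\<close> is approximated by \<open>a *\<^sub>R p + b *\<^sub>R q\<close>, and
    \<open>- y\<close> by the same combination with \<open>p\<close> and \<open>q\<close> exchanged.
    In the sum of the two errors both norms get the total weight \<open>a + b = 1\<close>.\<close>
  define a b where "a = (1 + norm y) / 2" and "b = (1 - norm y) / 2"
  have ab: "0 \<le> a" "0 \<le> b" "a + b = 1" and nab: "norm y = a - b"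
    using y by (auto simp: a_def b_def unit_ball_of_def field_simps)
  have "y = (a - b) *\<^sub>R u"
    using yu nab by simp
  then have "y - (a *\<^sub>R p + b *\<^sub>R q) = a *\<^sub>R (u - p) - b *\<^sub>R (u + q)"
    and "y + (a *\<^sub>R q + b *\<^sub>R p) = a *\<^sub>R (u + q) - b *\<^sub>R (u - p)"
    by (simp_all add: algebra_simps)
  then have "norm (y - (a *\<^sub>R p + b *\<^sub>R q)) \<le> a * norm (u - p) + b * norm (u + q)"
    and "norm (y + (a *\<^sub>R q + b *\<^sub>R p)) \<le> a * norm (u + q) + b * norm (u - p)"
    using ab norm_triangle_ineq4[of "a *\<^sub>R (u - p)" "b *\<^sub>R (u + q)"]
      norm_triangle_ineq4[of "a *\<^sub>R (u + q)" "b *\<^sub>R (u - p)"] by simp_all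
  then have "dist y (a *\<^sub>R p + b *\<^sub>R q) + dist y (- (a *\<^sub>R q + b *\<^sub>R p))
      \<le> (a + b) * (norm (u - p) + norm (u + q))"
    unfolding dist_norm diff_minus_eq_add distrib_left distrib_right by linarith
  then have "dist y (a *\<^sub>R p + b *\<^sub>R q) + dist y (- (a *\<^sub>R q + b *\<^sub>R p)) < 2 + \<epsilon>"
    using pq ab by simp
  then show ?thesis
    using slice_convex_comb[OF Y f] p(1) q(1) ab by blast
qed

section \<open>Functions with a prescribed value, and evaluation functionals\<close>

lemma bcontfun_prescribe_value:
  fixes h :: "'k::topological_space \<Rightarrow>\<^sub>C 'e::real_normed_vector"
  assumes F: "subspace F" and h: "h \<in> unit_ball_of (PiC UNIV (\<lambda>_. F))"
    and u: "u \<in> unit_ball_of F" and "\<delta> > 0"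
  obtains g where "g \<in> unit_ball_of (PiC UNIV (\<lambda>_. F))" "apply_bcontfun g t = u"
    "dist h g \<le> dist (h t) u + \<delta>"
proof -
  \<comment> \<open>A continuous cut-off built from \<open>h\<close> itself: it is 1 at
    \<open>t\<close> and vanishes wherever \<open>h\<close> is at distance at least
    \<open>\<delta>\<close> from \<open>h t\<close>.\<close>
  define \<alpha> where "\<alpha> = (\<lambda>s. max 0 (1 - dist (h s) (h t) / \<delta>))"
  have \<alpha>: "0 \<le> \<alpha> s" "\<alpha> s \<le> 1" for s
    using \<open>\<delta> > 0\<close> by (auto simp: \<alpha>_def)
  \<comment> \<open>A pointwise convex combination, so it stays in the unit ball and in the subspace
    \<open>F\<close>.\<close>
  define g0 where "g0 = (\<lambda>s. (1 - \<alpha> s) *\<^sub>R h s + \<alpha> s *\<^sub>R u)"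
  have hF: "h s \<in> F" "norm (h s) \<le> 1" for s
    using h norm_bounded[of h s] by (auto simp: unit_ball_of_def mem_PiC_iff)
  have uF: "u \<in> F" "norm u \<le> 1"
    using u by (auto simp: unit_ball_of_def)
  have "continuous_on UNIV g0"
    unfolding g0_def \<alpha>_def using \<open>\<delta> > 0\<close> by (intro continuous_intros) auto
  moreover have g0n: "norm (g0 s) \<le> 1" for s
    unfolding g0_def using \<alpha>[of s] hF[of s] uF convex_bound_le[of "norm (h s)" 1 "norm u" "1 - \<alpha> s" "\<alpha> s"]
    by (intro norm_triangle_le) simp
  ultimately have "g0 \<in> bcontfun"
    by (rule bcontfun_normI)
  then obtain g where g: "g0 = apply_bcontfun g"
    by (rule bcontfunE)
  show thesis
  proof
    have "norm g \<le> 1"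
      using g0n unfolding g by (rule norm_bound)
    moreover have "g0 s \<in> F" for s
      unfolding g0_def using F hF uF by (simp add: subspace_add subspace_scale)
    ultimately show "g \<in> unit_ball_of (PiC UNIV (\<lambda>_. F))"
      by (auto simp: unit_ball_of_def mem_PiC_iff g)
    show "apply_bcontfun g t = u"
      by (simp add: g[symmetric] g0_def \<alpha>_def)
    show "dist h g \<le> dist (h t) u + \<delta>"
    proof (rule dist_bound)
      fix s
      have "h s - g0 s = \<alpha> s *\<^sub>R (h s - u)"
        by (simp add: g0_def algebra_simps)
      then have *: "dist (h s) (g s) = \<alpha> s * dist (h s) u"
        using \<alpha>(1)[of s] by (simp add: dist_norm g[symmetric])
      show "dist (h s) (g s) \<le> dist (h t) u + \<delta>"
      \<comment> \<open>Near the value \<open>h t\<close> the triangle inequality through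
        \<open>h t\<close> costs at most \<open>\<delta>\<close>; elsewhere the cut-off is zero and
        \<open>g\<close> agrees with \<open>h\<close>.\<close>
      proof (cases "dist (h s) (h t) \<le> \<delta>")
        case True
        have "\<alpha> s * dist (h s) u \<le> dist (h s) u"
          using \<alpha>[of s] by (simp add: mult_left_le_one_le)
        also have "\<dots> \<le> dist (h s) (h t) + dist (h t) u"
          by (rule dist_triangle)
        finally show ?thesis
          using True * by simp
      next
        case False
        then have "\<alpha> s = 0"
          using \<open>\<delta> > 0\<close> by (simp add: \<alpha>_def field_simps)
        then show ?thesis
          using * \<open>\<delta> > 0\<close> by simp
      qed
    qed
  qed
qed

lemma norm_attained_bcontfun:
  fixes f :: "'k::topological_space \<Rightarrow>\<^sub>C 'e::real_normed_vector"
  assumes "compact (UNIV :: 'k set)"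
  obtains t where "norm (f t) = norm f"
proof -
  have "continuous_on UNIV (\<lambda>t. norm (f t))"
    by (intro continuous_intros continuous_on_apply_bcontfun)
  then obtain t where "\<And>s. norm (f s) \<le> norm (f t)"
    using continuous_attains_sup[OF assms] by blast
  then have "norm f \<le> norm (f t)"
    by (rule norm_bound)
  with norm_bounded[of f t] that show thesis
    by fastforce
qed

text \<open>Evaluation at \<open>t\<close> maps the unit ball of C(K, F) onto that of
  \<open>F\<close>: it does not increase norms, and constant functions realise every value. The two
  suprema are thus taken over the same set of reals.\<close>

lemma dual_sphere_of_eval:
  fixes F :: "'e::real_normed_vector set" and t :: "'k::topological_space"
  assumes "x' \<in> dual_sphere_of F"
  shows "(\<lambda>g. x' (apply_bcontfun g t)) \<in> dual_sphere_of (PiC UNIV (\<lambda>_. F))"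
proof -
  have "(\<lambda>g. \<bar>x' (apply_bcontfun g t)\<bar>) ` unit_ball_of (PiC UNIV (\<lambda>_. F))
      = (\<lambda>z. \<bar>x' z\<bar>) ` unit_ball_of F" (is "?L = ?R")
  proof
    show "?L \<subseteq> ?R"
      using norm_bounded order_trans
      by (fastforce simp: unit_ball_of_def mem_PiC_iff)
    show "?R \<subseteq> ?L"
    proof
      fix r assume "r \<in> ?R"
      then obtain z where "z \<in> unit_ball_of F" "r = \<bar>x' z\<bar>"
        by blast
      moreover have "const_bcontfun z \<in> unit_ball_of (PiC UNIV (\<lambda>_. F) :: ('k \<Rightarrow>\<^sub>C 'e) set)"
        using \<open>z \<in> unit_ball_of F\<close> by (auto simp: unit_ball_of_def mem_PiC_iff intro!: norm_bound)
      ultimately show "r \<in> ?L"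
        by (intro image_eqI[of _ _ "const_bcontfun z"]) simp_all
    qed
  qed
  then show ?thesis
    using assms by (auto simp: dual_sphere_of_def mem_PiC_iff Pi_iff)
qed

section \<open>Passage of the GL-property from F to C(K, F), and the local version\<close>

lemma GL_space_PiC:
  fixes F :: "'e::banach set"
  assumes "compact (UNIV :: 'k::topological_space set)" and "GL_space F"
  shows "GL_space (PiC UNIV (\<lambda>_. F) :: ('k \<Rightarrow>\<^sub>C 'e) set)" (is "GL_space ?C")
proof -
  have F: "banach_subspace F" "subspace F"
    using assms(2) by (auto simp: GL_space_def banach_subspace_def)
  have "\<exists>\<phi>\<in>dual_sphere_of ?C. f \<in> slice ?C \<phi> \<epsilon> \<and>
      (\<forall>h\<in>unit_sphere_of ?C.
        infdist h (slice ?C \<phi> \<epsilon>) + infdist h (uminus ` slice ?C \<phi> \<epsilon>) < 2 + \<epsilon>)"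
    if f: "f \<in> unit_sphere_of ?C" and "\<epsilon> > 0" for f :: "'k \<Rightarrow>\<^sub>C 'e" and \<epsilon> :: real
  proof -
    obtain t where t: "norm (f t) = norm f"
      by (rule norm_attained_bcontfun[OF assms(1)])
    then have ft: "f t \<in> unit_sphere_of F"
      using f by (auto simp: unit_sphere_of_def mem_PiC_iff)
    then obtain x' where x': "x' \<in> dual_sphere_of F" "f t \<in> slice F x' \<epsilon>"
      and sphere: "\<And>y. y \<in> unit_sphere_of F \<Longrightarrow>
        infdist y (slice F x' \<epsilon>) + infdist y (uminus ` slice F x' \<epsilon>) < 2 + \<epsilon>"
      using assms(2) \<open>\<epsilon> > 0\<close> unfolding GL_space_def by metis
    define \<phi> where "\<phi> = (\<lambda>g :: 'k \<Rightarrow>\<^sub>C 'e. x' (g t))"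
    have "f \<in> slice ?C \<phi> \<epsilon>"
      using f x'(2) by (simp add: slice_def unit_sphere_of_def unit_ball_of_def \<phi>_def)
    moreover have "infdist h (slice ?C \<phi> \<epsilon>) + infdist h (uminus ` slice ?C \<phi> \<epsilon>) < 2 + \<epsilon>"
      if "h \<in> unit_sphere_of ?C" for h
    proof -
      \<comment> \<open>The distance from \<open>h\<close> to the negative of the slice is the
        distance from \<open>- h\<close> to the slice, so the interpolation is applied to both
        \<open>h\<close> and \<open>- h\<close>.\<close>
      have h: "h \<in> unit_ball_of ?C" "- h \<in> unit_ball_of ?C"
        using that F(2) by (auto simp: unit_sphere_of_def unit_ball_of_def mem_PiC_iff
            Pi_iff subspace_uminus_iff)
      \<comment> \<open>Although \<open>h\<close> has norm one, its value at \<open>t\<close> may be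
        shorter; this is why the bound is required on the whole ball of \<open>F\<close>.\<close>
      then have "h t \<in> unit_ball_of F"
        using norm_bounded[of h t] by (auto simp: unit_ball_of_def mem_PiC_iff)
      then obtain p q where p: "p \<in> slice F x' \<epsilon>" and q: "q \<in> slice F x' \<epsilon>"
        and pq: "dist (h t) p + dist (h t) (- q) < 2 + \<epsilon>"
        using slice_approx_ball[OF F(2) x'(1) ft x'(2) sphere] by blast
      \<comment> \<open>A third of the slack: the two interpolations lose at most
        \<open>\<delta>\<close> each, and the remaining third keeps the inequality strict.\<close>
      define \<delta> where "\<delta> = (2 + \<epsilon> - (dist (h t) p + dist (h t) (- q))) / 3"
      have "\<delta> > 0"
        using pq by (simp add: \<delta>_def)
      have pq': "p \<in> unit_ball_of F" "q \<in> unit_ball_of F"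
        using p q by (auto simp: slice_def)
      obtain g where g: "g \<in> unit_ball_of ?C" "apply_bcontfun g t = p"
          "dist h g \<le> dist (h t) p + \<delta>"
        using bcontfun_prescribe_value[OF F(2) h(1) pq'(1) \<open>\<delta> > 0\<close>] by blast
      obtain k where k: "k \<in> unit_ball_of ?C" "apply_bcontfun k t = q"
          "dist (- h) k \<le> dist ((- h) t) q + \<delta>"
        using bcontfun_prescribe_value[OF F(2) h(2) pq'(2) \<open>\<delta> > 0\<close>] by blast
      \<comment> \<open>For functions in the unit ball, membership in the slice of
        \<open>\<phi>\<close> depends only on the value at \<open>t\<close>.\<close>
      have "g \<in> slice ?C \<phi> \<epsilon>" "k \<in> slice ?C \<phi> \<epsilon>"
        using g k p q by (auto simp: slice_def \<phi>_def)
      then have "infdist h (slice ?C \<phi> \<epsilon>) \<le> dist h g"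
        and "infdist h (uminus ` slice ?C \<phi> \<epsilon>) \<le> dist h (- k)"
        by (auto intro: infdist_le)
      moreover have "dist h (- k) = dist (- h) k" "dist (h t) (- q) = dist ((- h) t) q"
        by (metis dist_minus minus_minus, metis dist_minus minus_minus uminus_bcontfun.rep_eq)
      ultimately show ?thesis
        using g(3) k(3) \<open>\<delta> > 0\<close> unfolding \<delta>_def by argo
    qed
    ultimately show ?thesis
      using dual_sphere_of_eval[OF x'(1), of t] unfolding \<phi>_def by blast
  qed
  then show ?thesis
    using banach_subspace_PiC[OF F(1)] by (auto simp: GL_space_def)
qed

theorem proposition3p10:
  assumes "compact (UNIV :: 'k::t2_space set)"
    and "local_GL_space (UNIV :: 'e::banach set)"
  shows "local_GL_space (UNIV :: ('k \<Rightarrow>\<^sub>C 'e) set)"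
proof -
  have "banach_subspace (UNIV :: ('k \<Rightarrow>\<^sub>C 'e) set)"
  proof -
    \<comment> \<open>Taking \<open>F\<close> to be all of E turns completeness of C(K, E) into an
      instance of the result for C(K, F).\<close>
    have "PiC UNIV (\<lambda>_. UNIV) = (UNIV :: ('k \<Rightarrow>\<^sub>C 'e) set)"
      by (auto simp: mem_PiC_iff)
    then show ?thesis
      using banach_subspace_PiC[of UNIV] assms(2) by (metis local_GL_space_def)
  qed
  moreover have "\<exists>Y. X \<subseteq> Y \<and> Y \<subseteq> UNIV \<and> GL_space Y"
    if X: "separable_space (top_of_set X)" for X :: "('k \<Rightarrow>\<^sub>C 'e) set"
  proof -
    obtain Z where Z: "subspace Z" "separable_space (top_of_set Z)"
        "\<And>g t. g \<in> X \<Longrightarrow> apply_bcontfun g t \<in> Z"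
      using separable_values[OF assms(1) X] by blast
    then obtain F where "Z \<subseteq> F" "GL_space F"
      using assms(2) unfolding local_GL_space_def by blast
    moreover have "X \<subseteq> PiC UNIV (\<lambda>_. F)"
      using Z(3) \<open>Z \<subseteq> F\<close> unfolding mem_PiC_iff Pi_iff subset_iff by blast
    ultimately show ?thesis
      using GL_space_PiC[OF assms(1)] by blast
  qed
  ultimately show ?thesis
    by (simp add: local_GL_space_def)
qed

end
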